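(* Let $A:\mathbb{R}\to\mathbb{R}^{N\times N}$ be locally integrable and let $\mu$ be a growth rate. Suppose $\dot x=A(t)x$ has nonuniform $\mu$-bounded growth with constants $L\ge1$, $a>0$ and $\epsilon\ge0$. Then, for every $\tau\in\mathbb{R}$, the translated equation $\dot x=A(t+\tau)x$ has nonuniform $\mu_\tau$-bounded growth with constants $L_\tau:=L\cdot\mu(\tau)^{3\,\mathrm{sgn}(\tau)\epsilon}$, $a>0$ and $\epsilon\ge0$, where $\mu_\tau(t)=\mu(t+\tau)/\mu(\tau)$ is the $\tau$-translated growth rate.
   Context: A growth rate is a strictly increasing differentiable function $\mu:\mathbb{R}\to\mathbb{R}^+$ with $\mu(0)=1$, $\lim_{t\to+\infty}\mu(t)=+\infty$, $\lim_{t\to-\infty}\mu(t)=0$. A linear equation $\dot x=B(t)x$ ($B$ locally integrable) with evolution operator $\Phi$ has nonuniform $\sigma$-bounded growth, for a growth rate $\sigma$, with constants $L\ge1$, $a>0$, $\epsilon\ge0$ if $\|\Phi(t,s)\|\le L(\sigma(t)/\sigma(s))^{\mathrm{sgn}(t-s)a}\sigma(s)^{\mathrm{sgn}(s)\epsilon}$ for all $t,s\in\mathbb{R}$. *)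

theory Defs
  imports "HOL-Analysis.Analysis"
begin

definition growth_rate :: "(real \<Rightarrow> real) \<Rightarrow> bool" where
  "growth_rate \<mu> \<longleftrightarrow>
     strict_mono \<mu> \<and>
     (\<forall>t. \<mu> differentiable (at t)) \<and>
     (\<forall>t. \<mu> t > 0) \<and>
     \<mu> 0 = 1 \<and>
     filterlim \<mu> at_top at_top \<and>
     (\<mu> \<longlongrightarrow> 0) at_bot"

definition translated_rate :: "(real \<Rightarrow> real) \<Rightarrow> real \<Rightarrow> real \<Rightarrow> real" where
  "translated_rate \<mu> \<tau> t = \<mu> (t + \<tau>) / \<mu> \<tau>"

definition locally_integrable :: "(real \<Rightarrow> 'a::euclidean_space) \<Rightarrow> bool" where
  "locally_integrable f \<longleftrightarrow> (\<forall>a b. f absolutely_integrable_on {a..b})"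

text \<open>Since \<^term>\<open>B\<close> is only locally integrable, solutions of x' = B(t) x are understood in the
  sense of Caratheodory: \<^term>\<open>x\<close> is locally absolutely continuous and satisfies the equation
  almost everywhere, i.e. \<^term>\<open>x\<close> is an indefinite Lebesgue integral of B(t) x(t).\<close>

definition solves_linear ::
  "(real \<Rightarrow> real^'n^'n) \<Rightarrow> (real \<Rightarrow> real^'n) \<Rightarrow> bool" where
  "solves_linear B x \<longleftrightarrow>
     (\<forall>s t. s \<le> t \<longrightarrow>
        (\<lambda>u. B u *v x u) absolutely_integrable_on {s..t} \<and>
        x t - x s = integral {s..t} (\<lambda>u. B u *v x u))"

text \<open>\<^term>\<open>\<Phi>\<close> t s maps the value at time s of a solution to its value at time t.\<close>

definition evolution_operator ::
  "(real \<Rightarrow> real^'n^'n) \<Rightarrow> (real \<Rightarrow> real \<Rightarrow> real^'n^'n) \<Rightarrow> bool" where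
  "evolution_operator B \<Phi> \<longleftrightarrow>
     (\<forall>s. \<Phi> s s = mat 1) \<and>
     (\<forall>s \<xi>. solves_linear B (\<lambda>t. \<Phi> t s *v \<xi>))"

text \<open>For locally integrable \<^term>\<open>B\<close> there is exactly one evolution operator, so the existential
  quantifier below just names it. The norm is the operator norm induced by the Euclidean norm
  (the instance \<^const>\<open>norm\<close> on matrices is the Frobenius norm).\<close>

definition nonuniform_bounded_growth ::
  "(real \<Rightarrow> real^'n^'n) \<Rightarrow> (real \<Rightarrow> real) \<Rightarrow> real \<Rightarrow> real \<Rightarrow> real \<Rightarrow> bool" where
  "nonuniform_bounded_growth B \<sigma> L a \<epsilon> \<longleftrightarrow>
     locally_integrable B \<and> growth_rate \<sigma> \<and> L \<ge> 1 \<and> a > 0 \<and> \<epsilon> \<ge> 0 \<and>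
     (\<exists>\<Phi>. evolution_operator B \<Phi> \<and>
        (\<forall>t s. onorm ((*v) (\<Phi> t s)) \<le>
           L * (\<sigma> t / \<sigma> s) powr (sgn (t - s) * a) * \<sigma> s powr (sgn s * \<epsilon>)))"

end

theory Submission imports Defs begin

text \<open>If \<^term>\<open>\<Phi>\<close> t s is the evolution operator of A, then \<^term>\<open>\<Phi>\<close> (t + \<^term>\<open>\<tau>\<close>) (s + \<^term>\<open>\<tau>\<close>) is
  that of the translated equation, and ratios of the growth rate are unchanged by the normalisation,
  so only the nonuniform factor has to be compared. Since a growth rate \<^term>\<open>\<mu>\<close> increases through 1
  at 0, this factor is the exponential of \<^term>\<open>\<epsilon>\<close> times the absolute value of the logarithm of
  \<^term>\<open>\<mu>\<close>, and the comparison reduces to the triangle inequality for ln \<^term>\<open>\<mu>\<close> at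
  s + \<^term>\<open>\<tau>\<close> and \<^term>\<open>\<tau>\<close>.\<close>

text \<open>Absolute integrability is integrability of both \<open>f\<close> and its norm, and each
  of them is shifted separately.\<close>

lemma absolutely_integrable_translate:
  fixes f :: "real \<Rightarrow> 'a::euclidean_space"
  assumes "f absolutely_integrable_on {a + c..b + c}"
  shows "(\<lambda>x. f (x + c)) absolutely_integrable_on {a..b}"
  using assms integrable_shift_real_ivl[of f "a + c" "b + c" c]
    integrable_shift_real_ivl[of "\<lambda>x. norm (f x)" "a + c" "b + c" c]
  by (simp add: absolutely_integrable_on_def)

lemma locally_integrable_translate:
  "locally_integrable f \<Longrightarrow> locally_integrable (\<lambda>t. f (t + c))"
  by (simp add: locally_integrable_def absolutely_integrable_translate)

text \<open>The substitution u to u + \<open>c\<close> carries the integral equation on [s +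
  \<open>c\<close>, t + \<open>c\<close>] to the one on [s, t].\<close>

lemma solves_linear_translate:
  assumes "solves_linear B x"
  shows "solves_linear (\<lambda>t. B (t + c)) (\<lambda>t. x (t + c))"
  unfolding solves_linear_def
proof (intro allI impI conjI)
  fix s t :: real
  assume "s \<le> t"
  then have abs: "(\<lambda>u. B u *v x u) absolutely_integrable_on {s + c..t + c}"
    and eq: "x (t + c) - x (s + c) = integral {s + c..t + c} (\<lambda>u. B u *v x u)"
    using assms by (auto simp: solves_linear_def)
  show "(\<lambda>u. B (u + c) *v x (u + c)) absolutely_integrable_on {s..t}"
    using absolutely_integrable_translate[OF abs] .
  show "x (t + c) - x (s + c) = integral {s..t} (\<lambda>u. B (u + c) *v x (u + c))"
    using integral_shift_real_ivl[of "s + c" c "t + c" "\<lambda>u. B u *v x u"] eq by simp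
qed

lemma evolution_operator_translate:
  assumes "evolution_operator B \<Phi>"
  shows "evolution_operator (\<lambda>t. B (t + c)) (\<lambda>t s. \<Phi> (t + c) (s + c))"
  \<comment> \<open>The solution started at time s + \<open>c\<close> becomes, after translation,
    the one started at time s.\<close>
  using assms solves_linear_translate[of B "\<lambda>t. \<Phi> t (s + c) *v \<xi>" c for s \<xi>]
  by (simp add: evolution_operator_def)

lemma growth_rate_translated_rate:
  assumes "growth_rate \<mu>"
  shows "growth_rate (translated_rate \<mu> \<tau>)"
proof -
  have mono: "strict_mono \<mu>" and diff: "\<And>t. \<mu> differentiable (at t)"
    and pos: "\<And>t. \<mu> t > 0" and top: "filterlim \<mu> at_top at_top" and bot: "(\<mu> \<longlongrightarrow> 0) at_bot"
    using assms by (auto simp: growth_rate_def)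
  \<comment> \<open>Written as a shift followed by a constant positive factor, the rate inherits its
    derivative and both limits from \<mu>.\<close>
  have eq: "translated_rate \<mu> \<tau> = (\<lambda>t. \<mu> (t + \<tau>) * inverse (\<mu> \<tau>))"
    by (auto simp: translated_rate_def field_simps)
  have "strict_mono (translated_rate \<mu> \<tau>)"
    using mono pos by (auto simp: translated_rate_def strict_mono_def divide_strict_right_mono)
  moreover have "translated_rate \<mu> \<tau> differentiable (at t)" for t
  proof -
    have "(\<mu> \<circ> (\<lambda>t. t + \<tau>)) differentiable (at t)"
      by (intro differentiable_chain_at diff) (auto intro!: derivative_intros)
    then show ?thesis
      unfolding eq by (auto simp: o_def)
  qed
  moreover have "filterlim (translated_rate \<mu> \<tau>) at_top at_top"
  proof -
    have "filterlim (\<lambda>t. t + \<tau>) at_top at_top"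
      unfolding add.commute[of _ \<tau>]
      by (rule filterlim_tendsto_add_at_top[OF tendsto_const filterlim_ident])
    from filterlim_at_top_mult_tendsto_pos[OF tendsto_const _ filterlim_compose[OF top this]]
    show ?thesis
      unfolding eq by (simp add: pos)
  qed
  moreover have "(translated_rate \<mu> \<tau> \<longlongrightarrow> 0) at_bot"
  proof -
    have "filterlim (\<lambda>t. t + \<tau>) at_bot at_bot"
      unfolding filterlim_at_bot eventually_at_bot_linorder
      by (metis add_le_cancel_right diff_add_cancel order_trans)
    from tendsto_mult_left_zero[OF filterlim_compose[OF bot this]] show ?thesis
      unfolding eq .
  qed
  ultimately show ?thesis
    using pos by (simp add: growth_rate_def translated_rate_def less_imp_neq[THEN not_sym])
qed

text \<open>As ln \<mu> is increasing, its increment from \<tau> to s + \<tau> has the sign of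
  s.\<close>

lemma growth_rate_sgn_ln:
  assumes "growth_rate \<mu>"
  shows "sgn s * (ln (\<mu> (s + \<tau>)) - ln (\<mu> \<tau>)) = \<bar>ln (\<mu> (s + \<tau>)) - ln (\<mu> \<tau>)\<bar>"
proof -
  have "\<mu> (s + \<tau>) < \<mu> \<tau>" if "s < 0"
    using assms that by (auto simp: growth_rate_def strict_mono_def)
  moreover have "\<mu> \<tau> < \<mu> (s + \<tau>)" if "s > 0"
    using assms that by (auto simp: growth_rate_def strict_mono_def)
  moreover have "\<mu> \<tau> > 0" "\<mu> (s + \<tau>) > 0"
    using assms by (auto simp: growth_rate_def)
  ultimately show ?thesis
    by (cases s "0::real" rule: linorder_cases) auto
qed

text \<open>This is the case \<tau> = 0 of \<open>growth_rate_sgn_ln\<close>, where ln (\<mu> 0) =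
  0. No sign is imposed on \<epsilon>, and 3 * \<epsilon> may take its place.\<close>

lemma growth_rate_powr_sgn:
  assumes "growth_rate \<mu>"
  shows "\<mu> t powr (sgn t * \<epsilon>) = exp (\<epsilon> * \<bar>ln (\<mu> t)\<bar>)"
proof -
  have "\<mu> t > 0" "\<mu> 0 = 1"
    using assms by (auto simp: growth_rate_def)
  with growth_rate_sgn_ln[OF assms, of t 0] show ?thesis
    by (simp add: powr_def mult.commute mult.left_commute)
qed

lemma growth_rate_powr_sgn_translate:
  assumes "growth_rate \<mu>" and "\<epsilon> \<ge> 0"
  shows "\<mu> (s + \<tau>) powr (sgn (s + \<tau>) * \<epsilon>)
           \<le> \<mu> \<tau> powr (3 * sgn \<tau> * \<epsilon>) * translated_rate \<mu> \<tau> s powr (sgn s * \<epsilon>)"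
proof -
  have pos: "\<mu> t > 0" for t
    using assms(1) by (simp add: growth_rate_def)
  \<comment> \<open>The triangle inequality gives coefficient 1 for the term in ln (\<mu> \<tau>);
    it is enlarged to 3 to match the exponent in the claimed constant.\<close>
  have "\<epsilon> * \<bar>ln (\<mu> (s + \<tau>))\<bar> \<le> \<epsilon> * (3 * \<bar>ln (\<mu> \<tau>)\<bar> + \<bar>ln (\<mu> (s + \<tau>)) - ln (\<mu> \<tau>)\<bar>)"
    using assms(2) by (intro mult_left_mono) auto
  also have "\<dots> = 3 * \<epsilon> * \<bar>ln (\<mu> \<tau>)\<bar> + \<epsilon> * \<bar>ln (translated_rate \<mu> \<tau> s)\<bar>"
    using pos[of \<tau>] pos[of "s + \<tau>"] by (simp add: translated_rate_def ln_div algebra_simps)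
  finally show ?thesis
    \<comment> \<open>All three powers become exponentials; the last instance concerns the
      translated rate, which is itself a growth rate.\<close>
    using growth_rate_powr_sgn[OF assms(1), of "s + \<tau>" \<epsilon>]
      growth_rate_powr_sgn[OF assms(1), of \<tau> "3 * \<epsilon>"]
      growth_rate_powr_sgn[OF growth_rate_translated_rate[OF assms(1)], of \<tau> s \<epsilon>]
    by (simp add: exp_add[symmetric] mult_ac)
qed

theorem lemma2p8:
  fixes A :: "real \<Rightarrow> real^'n^'n" and \<mu> :: "real \<Rightarrow> real" and L a \<epsilon> :: real
  assumes "locally_integrable A"
    and "growth_rate \<mu>"
    and "L \<ge> 1" and "a > 0" and "\<epsilon> \<ge> 0"
    and "nonuniform_bounded_growth A \<mu> L a \<epsilon>"
  shows "\<forall>\<tau>. nonuniform_bounded_growth (\<lambda>t. A (t + \<tau>)) (translated_rate \<mu> \<tau>)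
                (L * \<mu> \<tau> powr (3 * sgn \<tau> * \<epsilon>)) a \<epsilon>"
proof
  fix \<tau>
  obtain \<Phi> where \<Phi>: "evolution_operator A \<Phi>"
    and bound: "\<And>t s. onorm ((*v) (\<Phi> t s)) \<le>
           L * (\<mu> t / \<mu> s) powr (sgn (t - s) * a) * \<mu> s powr (sgn s * \<epsilon>)"
    using assms(6) by (auto simp: nonuniform_bounded_growth_def)
  have pos: "\<mu> t > 0" for t
    using assms(2) by (simp add: growth_rate_def)
  \<comment> \<open>The power is the exponential of 3 * \<epsilon> * \<bar>ln (\<mu> \<tau>)\<bar>,
    which is nonnegative whatever the sign of \<tau>. Hence the new constant is again at least
    1.\<close>
  have "1 \<le> \<mu> \<tau> powr (3 * sgn \<tau> * \<epsilon>)"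
    using growth_rate_powr_sgn[OF assms(2), of \<tau> "3 * \<epsilon>"] assms(5) by (simp add: mult_ac)
  then have "1 * 1 \<le> L * \<mu> \<tau> powr (3 * sgn \<tau> * \<epsilon>)"
    using assms(3) by (intro mult_mono) auto
  moreover have "onorm ((*v) (\<Phi> (t + \<tau>) (s + \<tau>))) \<le>
      L * \<mu> \<tau> powr (3 * sgn \<tau> * \<epsilon>)
        * (translated_rate \<mu> \<tau> t / translated_rate \<mu> \<tau> s) powr (sgn (t - s) * a)
        * translated_rate \<mu> \<tau> s powr (sgn s * \<epsilon>)" for t s
  proof -
    have ratio: "\<mu> (t + \<tau>) / \<mu> (s + \<tau>) = translated_rate \<mu> \<tau> t / translated_rate \<mu> \<tau> s"
      using pos[of \<tau>] by (simp add: translated_rate_def)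
    have "onorm ((*v) (\<Phi> (t + \<tau>) (s + \<tau>)))
        \<le> L * (translated_rate \<mu> \<tau> t / translated_rate \<mu> \<tau> s) powr (sgn (t - s) * a)
          * \<mu> (s + \<tau>) powr (sgn (s + \<tau>) * \<epsilon>)"
      using bound[of "t + \<tau>" "s + \<tau>"] by (simp add: ratio)
    \<comment> \<open>Only the nonuniform factor is enlarged; the factors before it are
      nonnegative.\<close>
    also have "\<dots> \<le> L * (translated_rate \<mu> \<tau> t / translated_rate \<mu> \<tau> s) powr (sgn (t - s) * a)
          * (\<mu> \<tau> powr (3 * sgn \<tau> * \<epsilon>) * translated_rate \<mu> \<tau> s powr (sgn s * \<epsilon>))"
      using assms(3)
      by (intro mult_left_mono growth_rate_powr_sgn_translate[OF assms(2,5)]) auto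
    finally show ?thesis
      by (simp only: mult_ac)
  qed
  ultimately show "nonuniform_bounded_growth (\<lambda>t. A (t + \<tau>)) (translated_rate \<mu> \<tau>)
      (L * \<mu> \<tau> powr (3 * sgn \<tau> * \<epsilon>)) a \<epsilon>"
    unfolding nonuniform_bounded_growth_def
    using locally_integrable_translate[OF assms(1)] growth_rate_translated_rate[OF assms(2)]
      evolution_operator_translate[OF \<Phi>, of \<tau>] assms(4,5)
    by auto
qed

end
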